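(* Let $M$ be a pointwise semi-slant submanifold of an almost contact metric manifold $(N,\phi,\xi,\eta,g)$ with the semi-slant function $\theta$, and let $TM=\mathcal{D}_1\oplus\mathcal{D}_2$ be the associated decomposition. Then $$g\big((T^2+\cos^2\theta\,(I-\eta\otimes\xi))(X),Y\big)=0\quad\text{for all } X,Y\in\Gamma(\mathcal{D}_2).$$
   Context: An almost contact metric manifold $(N,\phi,\xi,\eta,g)$ is a smooth manifold $N$ of dimension $2n+1$ with a tensor field $\phi$ of type $(1,1)$, a vector field $\xi$, a $1$-form $\eta$ and a Riemannian metric $g$ such that $\phi^2=-I+\eta\otimes\xi$, $\eta(\xi)=1$ and $g(\phi X,\phi Y)=g(X,Y)-\eta(X)\eta(Y)$ for all vector fields $X,Y$ (hence $\phi\xi=0$, $\eta\circ\phi=0$, $\eta(X)=g(X,\xi)$). A submanifold $M$ of $N$ is a pointwise semi-slant submanifold if there is a distribution $\mathcal{D}_1\subset TM$ on $M$ such that $TM=\mathcal{D}_1\oplus\mathcal{D}_2$, $\phi(\mathcal{D}_1)\subset\mathcal{D}_1$, and at each given point $p\in M$ the angle $\theta=\theta(X)$ between $\phi X$ and the space $(\mathcal{D}_2)_p$ is constant for nonzero $X\in(\mathcal{D}_2)_p$, where $\mathcal{D}_2$ is the orthogonal complement of $\mathcal{D}_1$ in $TM$. The function $\theta$ on $M$ is called the semi-slant function. For $X$ tangent to $M$ write $\phi X=TX+FX$, with $TX$ tangent to $M$ and $FX$ normal to $M$. *)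

theory Defs
  imports "HOL-Analysis.Analysis"
begin

section \<open>Smooth manifolds\<close>

primrec Ck_on :: "nat \<Rightarrow> 'e::euclidean_space set \<Rightarrow> ('e \<Rightarrow> 'f::real_normed_vector) \<Rightarrow> bool" where
  "Ck_on 0 S f \<longleftrightarrow> continuous_on S f"
| "Ck_on (Suc k) S f \<longleftrightarrow> (\<forall>x\<in>S. f differentiable (at x)) \<and>
     (\<forall>v. Ck_on k S (\<lambda>x. frechet_derivative f (at x) v))"

text \<open>Meant for open \<^term>\<open>S\<close> only.\<close>

definition smooth_on :: "'e::euclidean_space set \<Rightarrow> ('e \<Rightarrow> 'f::real_normed_vector) \<Rightarrow> bool" where
  "smooth_on S f \<longleftrightarrow> (\<forall>k. Ck_on k S f)"

text \<open>
  A chart is a pair of its domain and its coordinate map. A smooth manifold without boundary, of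
  dimension \<open>DIM('e)\<close>, is a type \<open>'a\<close> (Hausdorff and second countable by its type classes) together
  with a smooth atlas; the atlas need not be maximal.
\<close>

type_synonym ('a, 'e) chart = "'a set \<times> ('a \<Rightarrow> 'e)"

definition chart_inv :: "('a, 'e) chart \<Rightarrow> 'e \<Rightarrow> 'a" where
  "chart_inv c = inv_into (fst c) (snd c)"

definition smooth_atlas ::
    "('a::{t2_space, second_countable_topology}, 'e::euclidean_space) chart set \<Rightarrow> bool" where
  "smooth_atlas A \<longleftrightarrow>
     (\<Union>c\<in>A. fst c) = UNIV \<and>
     (\<forall>c\<in>A. open (fst c) \<and> open (snd c ` fst c) \<and>
        homeomorphism (fst c) (snd c ` fst c) (snd c) (chart_inv c)) \<and>
     (\<forall>c\<in>A. \<forall>d\<in>A. smooth_on (snd c ` (fst c \<inter> fst d)) (snd d \<circ> chart_inv c))"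

text \<open>
  Tangent spaces: for each point \<open>p\<close> a chart \<open>chart_at A p\<close> around \<open>p\<close> is selected, and the tangent
  space at \<open>p\<close> is the model space \<open>'e\<close>, a vector \<open>v\<close> standing for the tangent vector whose
  coordinates in \<open>chart_at A p\<close> are \<open>v\<close>. The same vector has coordinates
  \<open>chart_deriv (chart_at A p) c p v\<close> in any other chart \<open>c\<close> around \<open>p\<close>. As \<open>chart_at A p\<close> may jump
  with \<open>p\<close>, smoothness of fields is always expressed in fixed charts.
\<close>

definition chart_at :: "('a, 'e) chart set \<Rightarrow> 'a \<Rightarrow> ('a, 'e) chart" where
  "chart_at A p = (SOME c. c \<in> A \<and> p \<in> fst c)"

definition chart_deriv ::
    "('a, 'e::euclidean_space) chart \<Rightarrow> ('a, 'e) chart \<Rightarrow> 'a \<Rightarrow> 'e \<Rightarrow> 'e" where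
  "chart_deriv c d p = frechet_derivative (snd d \<circ> chart_inv c) (at (snd c p))"

definition tangent_map ::
    "('b, 'f::euclidean_space) chart set \<Rightarrow> ('a, 'e::euclidean_space) chart set \<Rightarrow>
     ('b \<Rightarrow> 'a) \<Rightarrow> 'b \<Rightarrow> 'f \<Rightarrow> 'e" where
  "tangent_map B A f p =
     frechet_derivative (snd (chart_at A (f p)) \<circ> f \<circ> chart_inv (chart_at B p))
       (at (snd (chart_at B p) p))"

definition smooth_immersion ::
    "('b::topological_space, 'f::euclidean_space) chart set \<Rightarrow>
     ('a::topological_space, 'e::euclidean_space) chart set \<Rightarrow> ('b \<Rightarrow> 'a) \<Rightarrow> bool" where
  "smooth_immersion B A f \<longleftrightarrow>
     continuous_on UNIV f \<and>
     (\<forall>c\<in>B. \<forall>d\<in>A. smooth_on (snd c ` (fst c \<inter> f -` fst d)) (snd d \<circ> f \<circ> chart_inv c)) \<and>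
     (\<forall>p. inj (tangent_map B A f p))"

section \<open>Fields and distributions\<close>

definition smooth_function_on ::
    "('a, 'e::euclidean_space) chart set \<Rightarrow> 'a set \<Rightarrow> ('a \<Rightarrow> real) \<Rightarrow> bool" where
  "smooth_function_on A W f \<longleftrightarrow> (\<forall>c\<in>A. smooth_on (snd c ` (fst c \<inter> W)) (f \<circ> chart_inv c))"

definition smooth_vector_field_on ::
    "('a, 'e::euclidean_space) chart set \<Rightarrow> 'a set \<Rightarrow> ('a \<Rightarrow> 'e) \<Rightarrow> bool" where
  "smooth_vector_field_on A W X \<longleftrightarrow>
     (\<forall>c\<in>A. smooth_on (snd c ` (fst c \<inter> W))
        ((\<lambda>p. chart_deriv (chart_at A p) c p (X p)) \<circ> chart_inv c))"

text \<open>The vector field on \<open>fst c\<close> whose coordinates in the chart \<open>c\<close> are constantly \<open>v\<close>.\<close>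

definition coord_field ::
    "('a, 'e::euclidean_space) chart set \<Rightarrow> ('a, 'e) chart \<Rightarrow> 'e \<Rightarrow> 'a \<Rightarrow> 'e" where
  "coord_field A c v p = chart_deriv c (chart_at A p) p v"

definition one_form :: "('a, 'e::euclidean_space) chart set \<Rightarrow> ('a \<Rightarrow> 'e \<Rightarrow> real) \<Rightarrow> bool" where
  "one_form A \<eta> \<longleftrightarrow>
     (\<forall>p. linear (\<eta> p)) \<and>
     (\<forall>c\<in>A. \<forall>v. smooth_function_on A (fst c) (\<lambda>p. \<eta> p (coord_field A c v p)))"

definition tensor_field_1_1 ::
    "('a, 'e::euclidean_space) chart set \<Rightarrow> ('a \<Rightarrow> 'e \<Rightarrow> 'e) \<Rightarrow> bool" where
  "tensor_field_1_1 A \<phi> \<longleftrightarrow>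
     (\<forall>p. linear (\<phi> p)) \<and>
     (\<forall>c\<in>A. \<forall>v. smooth_vector_field_on A (fst c) (\<lambda>p. \<phi> p (coord_field A c v p)))"

definition riemannian_metric ::
    "('a, 'e::euclidean_space) chart set \<Rightarrow> ('a \<Rightarrow> 'e \<Rightarrow> 'e \<Rightarrow> real) \<Rightarrow> bool" where
  "riemannian_metric A g \<longleftrightarrow>
     (\<forall>p. bilinear (g p) \<and> (\<forall>u v. g p u v = g p v u) \<and> (\<forall>v. v \<noteq> 0 \<longrightarrow> g p v v > 0)) \<and>
     (\<forall>c\<in>A. \<forall>u v. smooth_function_on A (fst c)
        (\<lambda>p. g p (coord_field A c u p) (coord_field A c v p)))"

definition smooth_distribution ::
    "('a::topological_space, 'e::euclidean_space) chart set \<Rightarrow> ('a \<Rightarrow> 'e set) \<Rightarrow> bool" where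
  "smooth_distribution A D \<longleftrightarrow>
     (\<exists>k. \<forall>p. subspace (D p) \<and> dim (D p) = k \<and>
        (\<exists>W X. open W \<and> p \<in> W \<and> (\<forall>i<k. smooth_vector_field_on A W (X i)) \<and>
           (\<forall>q\<in>W. D q = span ((\<lambda>i. X i q) ` {..<k}))))"

definition smooth_section ::
    "('a, 'e::euclidean_space) chart set \<Rightarrow> ('a \<Rightarrow> 'e set) \<Rightarrow> ('a \<Rightarrow> 'e) \<Rightarrow> bool" where
  "smooth_section A D X \<longleftrightarrow> smooth_vector_field_on A UNIV X \<and> (\<forall>p. X p \<in> D p)"

section \<open>Almost contact metric manifolds\<close>

definition almost_contact_metric_manifold ::
    "('a::{t2_space, second_countable_topology}, 'e::euclidean_space) chart set \<Rightarrow>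
     ('a \<Rightarrow> 'e \<Rightarrow> 'e) \<Rightarrow> ('a \<Rightarrow> 'e) \<Rightarrow> ('a \<Rightarrow> 'e \<Rightarrow> real) \<Rightarrow> ('a \<Rightarrow> 'e \<Rightarrow> 'e \<Rightarrow> real) \<Rightarrow> bool" where
  "almost_contact_metric_manifold A \<phi> \<xi> \<eta> g \<longleftrightarrow>
     smooth_atlas A \<and> (\<exists>n. DIM('e) = 2 * n + 1) \<and>
     tensor_field_1_1 A \<phi> \<and> smooth_vector_field_on A UNIV \<xi> \<and> one_form A \<eta> \<and>
     riemannian_metric A g \<and>
     (\<forall>p u. \<phi> p (\<phi> p u) = - u + \<eta> p u *\<^sub>R \<xi> p) \<and>
     (\<forall>p. \<eta> p (\<xi> p) = 1) \<and>
     (\<forall>p u v. g p (\<phi> p u) (\<phi> p v) = g p u v - \<eta> p u * \<eta> p v)"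

section \<open>Pointwise semi-slant submanifolds\<close>

text \<open>
  Angles with respect to an inner product \<open>b\<close>. The angle between a nonzero vector and a nonzero
  subspace is the least angle the vector makes with nonzero elements of the subspace.
\<close>

definition angle :: "('e \<Rightarrow> 'e \<Rightarrow> real) \<Rightarrow> 'e \<Rightarrow> 'e \<Rightarrow> real" where
  "angle b v w = arccos (b v w / (sqrt (b v v) * sqrt (b w w)))"

definition angle_subspace :: "('e::real_vector \<Rightarrow> 'e \<Rightarrow> real) \<Rightarrow> 'e \<Rightarrow> 'e set \<Rightarrow> real" where
  "angle_subspace b v S = (INF w\<in>S - {0}. angle b v w)"

text \<open>
  A submanifold of \<open>(N, g)\<close> is a manifold with atlas \<open>B\<close> and a smooth immersion \<open>\<iota>\<close> into \<open>N\<close>.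
  Distributions on it live in its own tangent spaces; these are compared with those of \<open>N\<close> through
  the differential of \<open>\<iota>\<close>.
\<close>

definition orth_complement ::
    "('b, 'f::euclidean_space) chart set \<Rightarrow> ('a, 'e::euclidean_space) chart set \<Rightarrow>
     ('a \<Rightarrow> 'e \<Rightarrow> 'e \<Rightarrow> real) \<Rightarrow> ('b \<Rightarrow> 'a) \<Rightarrow> ('b \<Rightarrow> 'f set) \<Rightarrow> 'b \<Rightarrow> 'f set" where
  "orth_complement B A g \<iota> D p =
     {u. \<forall>w\<in>D p. g (\<iota> p) (tangent_map B A \<iota> p u) (tangent_map B A \<iota> p w) = 0}"

definition normal_space ::
    "('b, 'f::euclidean_space) chart set \<Rightarrow> ('a, 'e::euclidean_space) chart set \<Rightarrow>
     ('a \<Rightarrow> 'e \<Rightarrow> 'e \<Rightarrow> real) \<Rightarrow> ('b \<Rightarrow> 'a) \<Rightarrow> 'b \<Rightarrow> 'e set" where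
  "normal_space B A g \<iota> p = {v. \<forall>w. g (\<iota> p) v (tangent_map B A \<iota> p w) = 0}"

text \<open>The operator \<open>T\<close> of the decomposition \<open>\<phi> X = T X + F X\<close> into tangential and normal parts.\<close>

definition tangential_part ::
    "('b, 'f::euclidean_space) chart set \<Rightarrow> ('a, 'e::euclidean_space) chart set \<Rightarrow>
     ('a \<Rightarrow> 'e \<Rightarrow> 'e) \<Rightarrow> ('a \<Rightarrow> 'e \<Rightarrow> 'e \<Rightarrow> real) \<Rightarrow> ('b \<Rightarrow> 'a) \<Rightarrow> 'b \<Rightarrow> 'f \<Rightarrow> 'f" where
  "tangential_part B A \<phi> g \<iota> p u =
     (THE w. \<exists>n\<in>normal_space B A g \<iota> p.
        \<phi> (\<iota> p) (tangent_map B A \<iota> p u) = tangent_map B A \<iota> p w + n)"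

text \<open>
  \<open>D\<^sub>1\<close> is the invariant distribution and \<open>\<theta>\<close> the semi-slant function. The angle is only meaningful
  when \<open>\<phi> X \<noteq> 0\<close>; it is not constrained for \<open>X\<close> proportional to \<open>\<xi>\<close>, where \<open>\<phi> X = 0\<close>.
\<close>

definition pointwise_semi_slant_submanifold ::
    "('b::{t2_space, second_countable_topology}, 'f::euclidean_space) chart set \<Rightarrow>
     ('a::{t2_space, second_countable_topology}, 'e::euclidean_space) chart set \<Rightarrow>
     ('a \<Rightarrow> 'e \<Rightarrow> 'e) \<Rightarrow> ('a \<Rightarrow> 'e \<Rightarrow> 'e \<Rightarrow> real) \<Rightarrow> ('b \<Rightarrow> 'a) \<Rightarrow>
     ('b \<Rightarrow> 'f set) \<Rightarrow> ('b \<Rightarrow> real) \<Rightarrow> bool" where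
  "pointwise_semi_slant_submanifold B A \<phi> g \<iota> D\<^sub>1 \<theta> \<longleftrightarrow>
     smooth_atlas B \<and> smooth_immersion B A \<iota> \<and> smooth_distribution B D\<^sub>1 \<and>
     (let D\<^sub>2 = orth_complement B A g \<iota> D\<^sub>1; d\<iota> = tangent_map B A \<iota> in
        \<forall>p. (\<forall>u. \<exists>v\<in>D\<^sub>1 p. \<exists>w\<in>D\<^sub>2 p. u = v + w) \<and> D\<^sub>1 p \<inter> D\<^sub>2 p = {0} \<and>
            \<phi> (\<iota> p) ` d\<iota> p ` D\<^sub>1 p \<subseteq> d\<iota> p ` D\<^sub>1 p \<and>
            (\<forall>u\<in>D\<^sub>2 p. u \<noteq> 0 \<and> \<phi> (\<iota> p) (d\<iota> p u) \<noteq> 0 \<longrightarrow>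
               angle_subspace (g (\<iota> p)) (\<phi> (\<iota> p) (d\<iota> p u)) (d\<iota> p ` D\<^sub>2 p) = \<theta> p))"

end

theory Submission
  imports Defs
begin

text \<open>
  The statement is pointwise. On \<open>T\<^sub>pN\<close> the endomorphism \<open>\<phi>\<close> is skew for \<open>g\<close>, so it maps \<open>\<D>\<^sub>2\<close> into
  the orthogonal complement of the invariant \<open>\<D>\<^sub>1\<close>. Hence for \<open>u \<in> \<D>\<^sub>2\<close> the tangential part \<open>T u\<close> is
  the orthogonal projection of \<open>\<phi> u\<close> to \<open>\<D>\<^sub>2\<close>, and the slant condition reads
  \<open>|T u|\<^sup>2 = cos\<^sup>2 \<theta> |\<phi> u|\<^sup>2 = cos\<^sup>2 \<theta> (|u|\<^sup>2 - \<eta>(u)\<^sup>2)\<close>. Polarization gives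
  \<open>g(T u, T v) = cos\<^sup>2 \<theta> (g(u, v) - \<eta>(u) \<eta>(v))\<close>, and the left-hand side is \<open>-g(T\<^sup>2 u, v)\<close> by skewness.
\<close>

section \<open>Orthogonal projection and angles for an inner product given as a bilinear
  form\<close>

locale inner_form =
  fixes b :: "'e::euclidean_space \<Rightarrow> 'e \<Rightarrow> real"
  assumes bilin: "bilinear b"
    and sym: "b u v = b v u"
    and pos: "v \<noteq> 0 \<Longrightarrow> b v v > 0"
begin

lemmas form_simps = bilinear_ladd[OF bilin] bilinear_radd[OF bilin] bilinear_lmul[OF bilin]
  bilinear_rmul[OF bilin] bilinear_lneg[OF bilin] bilinear_rneg[OF bilin]
  bilinear_lzero[OF bilin] bilinear_rzero[OF bilin] bilinear_lsub[OF bilin] bilinear_rsub[OF bilin]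

lemma nonneg: "b v v \<ge> 0"
  using pos[of v] by (cases "v = 0") (auto simp: form_simps)

lemma eq_zero_iff: "b v v = 0 \<longleftrightarrow> v = 0"
  using pos[of v] bilinear_lzero[OF bilin] by (metis less_irrefl)

lemma Cauchy_Schwarz: "(b u v)\<^sup>2 \<le> b u u * b v v"
proof (cases "v = 0")
  case False
  \<comment> \<open>Up to the factor \<open>b v v\<close>, this is the component of \<open>u\<close>
    orthogonal to \<open>v\<close>.\<close>
  define w where "w = b v v *\<^sub>R u - b u v *\<^sub>R v"
  have "b w w = b v v * (b u u * b v v - (b u v)\<^sup>2)"
    by (simp add: w_def form_simps sym[of v u] power2_eq_square algebra_simps)
  then show ?thesis
    using nonneg[of w] pos[OF False] by (simp add: zero_le_mult_iff)
qed (simp add: form_simps)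

lemma Cauchy_Schwarz_abs: "\<bar>b u v\<bar> \<le> sqrt (b u u) * sqrt (b v v)"
  using Cauchy_Schwarz[of u v] by (metis real_sqrt_abs real_sqrt_le_iff real_sqrt_mult)

text \<open>Makes the definite description in \<open>tangential_part\<close> well defined. The form
  pulled back along \<open>L\<close> is positive definite, so its Gram operator \<open>G\<close> is
  injective, hence surjective in finite dimension.\<close>

lemma ex1_tangential_part:
  fixes L :: "'f::euclidean_space \<Rightarrow> 'e"
  assumes L: "linear L" "inj L"
  shows "\<exists>!w. \<exists>n\<in>{n. \<forall>x. b n (L x) = 0}. v = L w + n"
proof -
  define G where "G w = (\<Sum>i\<in>Basis. b (L w) (L i) *\<^sub>R i)" for w
  have lin: "linear (\<lambda>x. b u (L x))" for u
    by (rule linearI) (simp_all add: linear_add[OF L(1)] linear_scale[OF L(1)] form_simps)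
  have G_inner: "G w \<bullet> x = b (L w) (L x)" for w x
  proof -
    have "b (L w) (L x) = b (L w) (L (\<Sum>i\<in>Basis. (x \<bullet> i) *\<^sub>R i))"
      by (simp add: euclidean_representation)
    also have "\<dots> = (\<Sum>i\<in>Basis. (x \<bullet> i) * b (L w) (L i))"
      by (simp add: linear_sum[OF lin] linear_scale[OF lin])
    finally show ?thesis
      by (simp add: G_def inner_sum_left inner_commute[of x] mult.commute)
  qed
  have "linear G"
    by (rule linearI) (simp_all add: vector_eq_rdot[symmetric] inner_add_left G_inner
        linear_add[OF L(1)] linear_scale[OF L(1)] form_simps)
  moreover have inj: "w = 0" if "G w = 0" for w
    using G_inner[of w w] that L by (simp add: eq_zero_iff linear_injective_0)
  ultimately have surj: "surj G"
    by (simp add: linear_injective_imp_surjective linear_injective_0)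
  \<comment> \<open>The right-hand side represents the functional
    \<open>\<lambda>x. b v (L x)\<close> in the Euclidean inner product.\<close>
  obtain w where w: "G w = (\<Sum>i\<in>Basis. b v (L i) *\<^sub>R i)"
    using surj by (metis surj_def)
  have normal: "b (v - L w) (L x) = 0" for x
  proof -
    have "b (v - L w) (L i) = 0" if "i \<in> Basis" for i
      using arg_cong[OF w, of "\<lambda>y. y \<bullet> i"] that by (simp add: G_inner form_simps)
    then have "b (v - L w) (L (\<Sum>i\<in>Basis. (x \<bullet> i) *\<^sub>R i)) = 0"
      by (simp add: linear_sum[OF lin] linear_scale[OF lin])
    then show ?thesis by (simp add: euclidean_representation)
  qed
  have unique: "w' = w''"
    if "\<forall>x. b n' (L x) = 0" "\<forall>x. b n'' (L x) = 0" "L w' + n' = L w'' + n''" for w' w'' n' n''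
  proof -
    have "L (w' - w'') = n'' - n'"
      using that(3) by (simp add: linear_diff[OF L(1)] algebra_simps)
    \<comment> \<open>This difference is both tangential and normal, hence orthogonal to
      itself.\<close>
    then have "b (L (w' - w'')) (L (w' - w'')) = 0"
      using that by (metis bilinear_lsub[OF bilin] diff_self)
    then have "L (w' - w'') = 0" by (simp add: eq_zero_iff)
    then have "w' - w'' = 0" using L by (metis linear_injective_0)
    then show ?thesis by simp
  qed
  show ?thesis
  proof (rule ex1I[of _ w])
    show "\<exists>n\<in>{n. \<forall>x. b n (L x) = 0}. v = L w + n"
      using normal by (intro bexI[of _ "v - L w"]) simp_all
    fix w' assume "\<exists>n\<in>{n. \<forall>x. b n (L x) = 0}. v = L w' + n"
    then obtain n' where n': "\<forall>x. b n' (L x) = 0" "v = L w' + n'" by blast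
    have "L w' + n' = L w + (v - L w)" unfolding n'(2)[symmetric] by simp
    then show "w' = w" by (rule unique[OF n'(1) allI[OF normal]])
  qed
qed

text \<open>Here \<open>t\<close> is the orthogonal projection of \<open>v\<close> to
  \<open>S\<close>. Cauchy-Schwarz for \<open>t\<close> and \<open>w\<close> bounds the cosine of
  every angle between \<open>v\<close> and \<open>w\<close> in \<open>S\<close>, and the bound is
  attained, so the infimum is a minimum.\<close>

lemma cos_angle_subspace:
  assumes S: "S - {0} \<noteq> {}" and t: "t \<in> S" and v: "v \<noteq> 0"
    and proj: "\<And>w. w \<in> S \<Longrightarrow> b v w = b t w"
  shows "cos (angle_subspace b v S) = sqrt (b t t) / sqrt (b v v)"
proof -
  have vpos: "sqrt (b v v) > 0" using pos[OF v] by simp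
  define r where "r w = b v w / (sqrt (b v v) * sqrt (b w w))" for w
  have "\<bar>r w\<bar> \<le> 1" for w
    unfolding r_def using Cauchy_Schwarz_abs[of v w] nonneg[of v] nonneg[of w]
    by (auto simp: abs_mult divide_le_eq_1 less_le)
  then have bounds: "- 1 \<le> r w" "r w \<le> 1" for w
    by (simp_all only: abs_le_iff minus_le_iff)
  have ratio: "r w \<le> sqrt (b t t) / sqrt (b v v)" if "w \<in> S - {0}" for w
  proof -
    have "sqrt (b w w) > 0" using pos[of w] that by simp
    moreover have "b v w \<le> sqrt (b t t) * sqrt (b w w)"
      using Cauchy_Schwarz_abs[of t w] proj that by simp
    ultimately show ?thesis using vpos by (simp add: r_def field_simps)
  qed
  \<comment> \<open>The maximizer is \<open>t\<close> itself unless \<open>t = 0\<close>; then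
    \<open>v\<close> is orthogonal to \<open>S\<close> and any nonzero element serves.\<close>
  obtain m where m: "m \<in> S - {0}" "r m = sqrt (b t t) / sqrt (b v v)"
  proof (cases "t = 0")
    case True
    obtain m where "m \<in> S - {0}" using S by blast
    with True show ?thesis
      using proj[of m] by (intro that[of m]) (auto simp: r_def form_simps)
  next
    case False
    have "r t = (sqrt (b t t))\<^sup>2 / (sqrt (b v v) * sqrt (b t t))"
      using proj[OF t] nonneg[of t] by (simp add: r_def)
    also have "\<dots> = sqrt (b t t) / sqrt (b v v)"
      using pos[OF False] unfolding power2_eq_square
      by (intro mult_divide_mult_cancel_right) simp
    finally show ?thesis using that[of t] False t by simp
  qed
  have "angle_subspace b v S = arccos (r m)"
    unfolding angle_subspace_def angle_def r_def[symmetric]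
  proof (rule cInf_eq_minimum)
    show "arccos (r m) \<in> (\<lambda>w. arccos (r w)) ` (S - {0})" using m by blast
    fix x assume "x \<in> (\<lambda>w. arccos (r w)) ` (S - {0})"
    then obtain w where w: "w \<in> S - {0}" "x = arccos (r w)" by blast
    have "r w \<le> r m" using ratio[OF w(1)] m(2) by simp
    then show "arccos (r m) \<le> x"
      using bounds by (simp add: w(2) arccos_le_arccos)
  qed
  then show ?thesis
    using bounds[of m] by (simp only: m(2)[symmetric] cos_arccos)
qed

end

section \<open>Almost contact metric identities in one tangent space\<close>

locale contact_form = inner_form b
  for b :: "'e::euclidean_space \<Rightarrow> 'e \<Rightarrow> real" +
  fixes \<phi> :: "'e \<Rightarrow> 'e" and \<xi> :: 'e and \<eta> :: "'e \<Rightarrow> real"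
  assumes lin_phi: "linear \<phi>" and lin_eta: "linear \<eta>"
    and phi_phi: "\<phi> (\<phi> u) = - u + \<eta> u *\<^sub>R \<xi>"
    and eta_xi: "\<eta> \<xi> = 1"
    and compat: "b (\<phi> u) (\<phi> v) = b u v - \<eta> u * \<eta> v"
begin

text \<open>Since \<open>\<phi>\<close> squared kills \<open>\<xi>\<close>, the formula for the
  square at \<open>\<phi> \<xi>\<close> makes \<open>\<phi> \<xi>\<close> a multiple of
  \<open>\<xi>\<close>; applying \<open>\<phi>\<close> once more forces this multiple to
  vanish.\<close>

lemma phi_xi: "\<phi> \<xi> = 0"
proof -
  have sq: "\<phi> (\<phi> \<xi>) = 0" by (simp add: phi_phi eta_xi)
  have multiple: "\<phi> \<xi> = \<eta> (\<phi> \<xi>) *\<^sub>R \<xi>"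
    using phi_phi[of "\<phi> \<xi>"] sq by (simp add: linear_0[OF lin_phi] add_eq_0_iff)
  then have "\<eta> (\<phi> \<xi>) *\<^sub>R \<phi> \<xi> = 0"
    using sq by (metis linear_scale[OF lin_phi])
  then show ?thesis using multiple by fastforce
qed

text \<open>Compare two evaluations of the cube of \<open>\<phi>\<close>: apply
  \<open>\<phi>\<close> to the square at \<open>u\<close>, or take the square at
  \<open>\<phi> u\<close>.\<close>

lemma eta_phi: "\<eta> (\<phi> u) = 0"
proof -
  have "\<phi> (\<phi> (\<phi> u)) = - \<phi> u"
    unfolding phi_phi[of u]
    by (simp only: linear_add[OF lin_phi] linear_neg[OF lin_phi] linear_scale[OF lin_phi] phi_xi)
      simp
  then have "\<eta> (\<phi> u) *\<^sub>R \<xi> = 0" using phi_phi[of "\<phi> u"] by simp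
  then show ?thesis using eta_xi by (auto simp: linear_0[OF lin_eta])
qed

lemma form_xi: "b \<xi> v = \<eta> v"
  using compat[of \<xi> v] by (simp add: phi_xi eta_xi form_simps)

text \<open>Compatibility at \<open>\<phi> u\<close> and \<open>v\<close>; the \<open>\<xi>\<close>
  term of the square drops out because \<open>\<eta> (\<phi> v) = 0\<close>.\<close>

lemma phi_skew: "b (\<phi> u) v = - b u (\<phi> v)"
  using compat[of "\<phi> u" v] by (simp add: phi_phi eta_phi form_simps form_xi)

end

section \<open>The slant condition in one tangent space\<close>

text \<open>
  \<open>L\<close> plays the role of the differential of the immersion, \<open>D1\<close> and \<open>D2\<close> of the two distributions at
  one point, and \<open>T\<close> is characterized by \<open>\<phi> (L u) - L (T u)\<close> being normal.
\<close>

locale semi_slant_point = contact_form b \<phi> \<xi> \<eta>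
  for b :: "'e::euclidean_space \<Rightarrow> 'e \<Rightarrow> real" and \<phi> \<xi> \<eta> +
  fixes L :: "'f::euclidean_space \<Rightarrow> 'e" and D1 D2 :: "'f set" and T :: "'f \<Rightarrow> 'f" and \<theta> :: real
  assumes lin_L: "linear L" and inj_L: "inj L"
    and D2_eq: "D2 = {u. \<forall>w\<in>D1. b (L u) (L w) = 0}"
    and invariant: "\<phi> ` L ` D1 \<subseteq> L ` D1"
    and slant: "\<lbrakk>u \<in> D2; u \<noteq> 0; \<phi> (L u) \<noteq> 0\<rbrakk> \<Longrightarrow> angle_subspace b (\<phi> (L u)) (L ` D2) = \<theta>"
    and tangential: "b (\<phi> (L u)) (L x) = b (L (T u)) (L x)"
begin

lemma T_in_D2:
  assumes u: "u \<in> D2"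
  shows "T u \<in> D2"
  unfolding D2_eq
proof safe
  fix w assume "w \<in> D1"
  then obtain z where z: "z \<in> D1" "\<phi> (L w) = L z" using invariant by blast
  have "b (L (T u)) (L w) = - b (L u) (\<phi> (L w))" by (simp add: tangential[symmetric] phi_skew)
  also have "\<dots> = 0" using u z by (simp add: D2_eq)
  finally show "b (L (T u)) (L w) = 0" .
qed

lemma norm_T:
  assumes u: "u \<in> D2"
  shows "b (L (T u)) (L (T u)) = (cos \<theta>)\<^sup>2 * (b (L u) (L u) - \<eta> (L u) * \<eta> (L u))"
proof (cases "\<phi> (L u) = 0")
  \<comment> \<open>No angle is prescribed here, but both sides vanish: by \<open>compat\<close> the
    bracket is the squared length of \<open>\<phi> (L u)\<close>.\<close>
  case True
  then show ?thesis
    using compat[of "L u" "L u"] tangential[of u "T u"] by (simp add: form_simps)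
next
  case False
  then have "L u \<noteq> 0" by (metis linear_0 lin_phi)
  then have u0: "u \<noteq> 0" by (metis linear_0 lin_L)
  have "cos \<theta> = sqrt (b (L (T u)) (L (T u))) / sqrt (b (\<phi> (L u)) (\<phi> (L u)))"
    using cos_angle_subspace[of "L ` D2" "L (T u)" "\<phi> (L u)"] slant[OF u u0 False]
      \<open>L u \<noteq> 0\<close> u T_in_D2[OF u] False tangential by auto
  then have "(cos \<theta>)\<^sup>2 * b (\<phi> (L u)) (\<phi> (L u)) = b (L (T u)) (L (T u))"
    using nonneg pos[OF False] by (simp add: power_divide)
  then show ?thesis by (simp add: compat)
qed

text \<open>\<open>T\<close> is known only through pairings with tangent vectors, so additivity is
  obtained by showing that the defect is orthogonal to itself.\<close>

lemma T_add: "L (T (u + v)) = L (T u) + L (T v)"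
proof -
  let ?d = "T (u + v) - T u - T v"
  have "b (L ?d) (L ?d) = 0"
    by (simp only: linear_diff[OF lin_L] form_simps tangential[symmetric] linear_add[OF lin_L]
        linear_add[OF lin_phi])
  then have "L ?d = 0" by (simp only: eq_zero_iff)
  then show ?thesis
    by (simp add: linear_diff[OF lin_L] linear_add[OF lin_L] algebra_simps)
qed

text \<open>Polarization: subtract \<open>norm_T\<close> at \<open>u\<close> and at \<open>v\<close>
  from \<open>norm_T\<close> at \<open>u + v\<close>.\<close>

lemma form_T_T:
  assumes u: "u \<in> D2" and v: "v \<in> D2"
  shows "b (L (T u)) (L (T v)) = (cos \<theta>)\<^sup>2 * (b (L u) (L v) - \<eta> (L u) * \<eta> (L v))"
proof -
  have "u + v \<in> D2" using u v by (simp add: D2_eq linear_add[OF lin_L] form_simps)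
  from norm_T[OF this] norm_T[OF u] norm_T[OF v] show ?thesis
    by (simp add: T_add linear_add[OF lin_L] linear_add[OF lin_eta] form_simps
        sym[of "L (T v)" "L (T u)"] sym[of "L v" "L u"] algebra_simps)
qed

lemma T_squared:
  assumes u: "u \<in> D2" and v: "v \<in> D2"
  shows "b (L (T (T u)) + (cos \<theta>)\<^sup>2 *\<^sub>R (L u - \<eta> (L u) *\<^sub>R \<xi>)) (L v) = 0"
proof -
  \<comment> \<open>\<open>T\<close> inherits skewness from \<open>\<phi>\<close>, because normal
    parts do not pair with tangent vectors.\<close>
  have "b (L (T (T u))) (L v) = - b (\<phi> (L v)) (L (T u))"
    by (simp add: tangential[symmetric] phi_skew sym[of "L (T u)"])
  also have "\<dots> = - b (L (T u)) (L (T v))" by (simp add: tangential sym[of "L (T v)"])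
  finally show ?thesis
    by (simp add: form_T_T[OF u v] form_simps form_xi)
qed

end

section \<open>From the manifold definitions to a single tangent space\<close>

lemma chart_at:
  assumes "smooth_atlas A"
  shows "chart_at A p \<in> A" "p \<in> fst (chart_at A p)"
proof -
  have "\<exists>c. c \<in> A \<and> p \<in> fst c" using assms unfolding smooth_atlas_def by blast
  then have "chart_at A p \<in> A \<and> p \<in> fst (chart_at A p)"
    unfolding chart_at_def by (rule someI_ex)
  then show "chart_at A p \<in> A" "p \<in> fst (chart_at A p)" by auto
qed

lemma smooth_on_imp_differentiable:
  assumes "smooth_on S f" "x \<in> S"
  shows "f differentiable (at x)"
proof -
  have "Ck_on (Suc 0) S f" using assms(1) unfolding smooth_on_def by blast
  then show ?thesis using assms(2) by simp
qed

text \<open>\<open>frechet_derivative\<close> is a choice operator, so linearity requires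
  differentiability of the coordinate expression of \<open>f\<close>, which the immersion supplies
  in the selected charts.\<close>

lemma linear_tangent_map:
  assumes "smooth_atlas A" "smooth_atlas B" "smooth_immersion B A f"
  shows "linear (tangent_map B A f p)"
proof -
  let ?c = "chart_at B p" and ?d = "chart_at A (f p)"
  have "smooth_on (snd ?c ` (fst ?c \<inter> f -` fst ?d)) (snd ?d \<circ> f \<circ> chart_inv ?c)"
    using assms(3) chart_at(1)[OF assms(1)] chart_at(1)[OF assms(2)]
    unfolding smooth_immersion_def by simp
  then have "(snd ?d \<circ> f \<circ> chart_inv ?c) differentiable (at (snd ?c p))"
    by (rule smooth_on_imp_differentiable) (simp add: chart_at(2)[OF assms(1)] chart_at(2)[OF assms(2)])
  then show ?thesis unfolding tangent_map_def by (rule linear_frechet_derivative)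
qed

theorem lemma7p5:
  fixes A :: "('a::{t2_space, second_countable_topology}, 'e::euclidean_space) chart set"
    and B :: "('b::{t2_space, second_countable_topology}, 'f::euclidean_space) chart set"
    and \<phi> :: "'a \<Rightarrow> 'e \<Rightarrow> 'e" and \<xi> :: "'a \<Rightarrow> 'e"
    and \<eta> :: "'a \<Rightarrow> 'e \<Rightarrow> real" and g :: "'a \<Rightarrow> 'e \<Rightarrow> 'e \<Rightarrow> real"
    and \<iota> :: "'b \<Rightarrow> 'a" and D\<^sub>1 D\<^sub>2 :: "'b \<Rightarrow> 'f set" and \<theta> :: "'b \<Rightarrow> real"
    and d\<iota> :: "'b \<Rightarrow> 'f \<Rightarrow> 'e" and T :: "'b \<Rightarrow> 'f \<Rightarrow> 'f"
    and X Y :: "'b \<Rightarrow> 'f" and p :: 'b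
  defines "D\<^sub>2 \<equiv> orth_complement B A g \<iota> D\<^sub>1"
    and "d\<iota> \<equiv> tangent_map B A \<iota>"
    and "T \<equiv> tangential_part B A \<phi> g \<iota>"
  assumes "almost_contact_metric_manifold A \<phi> \<xi> \<eta> g"
    and "pointwise_semi_slant_submanifold B A \<phi> g \<iota> D\<^sub>1 \<theta>"
    and "smooth_section B D\<^sub>2 X" and "smooth_section B D\<^sub>2 Y"
  shows "g (\<iota> p)
           (d\<iota> p (T p (T p (X p))) +
             (cos (\<theta> p))\<^sup>2 *\<^sub>R (d\<iota> p (X p) - \<eta> (\<iota> p) (d\<iota> p (X p)) *\<^sub>R \<xi> (\<iota> p)))
           (d\<iota> p (Y p)) = 0"
proof -
  have atlas_A: "smooth_atlas A"
    and linear: "linear (\<phi> q)" "linear (\<eta> q)"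
    and metric: "bilinear (g q)" "g q u v = g q v u" "w \<noteq> 0 \<Longrightarrow> g q w w > 0"
    and contact: "\<phi> q (\<phi> q u) = - u + \<eta> q u *\<^sub>R \<xi> q" "\<eta> q (\<xi> q) = 1"
      "g q (\<phi> q u) (\<phi> q v) = g q u v - \<eta> q u * \<eta> q v" for q u v w
    using assms(4) unfolding almost_contact_metric_manifold_def tensor_field_1_1_def one_form_def
      riemannian_metric_def by - (elim conjE, (erule allE[of _ q])+, blast)+
  have atlas_B: "smooth_atlas B" and imm: "smooth_immersion B A \<iota>"
    and invariant: "\<phi> (\<iota> p) ` d\<iota> p ` D\<^sub>1 p \<subseteq> d\<iota> p ` D\<^sub>1 p"
    and slant: "\<forall>u\<in>D\<^sub>2 p. u \<noteq> 0 \<and> \<phi> (\<iota> p) (d\<iota> p u) \<noteq> 0 \<longrightarrow>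
      angle_subspace (g (\<iota> p)) (\<phi> (\<iota> p) (d\<iota> p u)) (d\<iota> p ` D\<^sub>2 p) = \<theta> p"
    using assms(5) unfolding pointwise_semi_slant_submanifold_def Let_def D\<^sub>2_def d\<iota>_def
    by - (elim conjE allE[of _ p], assumption)+
  have L: "linear (d\<iota> p)" "inj (d\<iota> p)"
    using linear_tangent_map[OF atlas_A atlas_B imm] imm
    unfolding d\<iota>_def smooth_immersion_def by simp_all
  interpret contact_form "g (\<iota> p)" "\<phi> (\<iota> p)" "\<xi> (\<iota> p)" "\<eta> (\<iota> p)"
    by (intro contact_form.intro inner_form.intro contact_form_axioms.intro)
      (fact linear metric contact)+
  have tangential: "g (\<iota> p) (\<phi> (\<iota> p) (d\<iota> p u)) (d\<iota> p x) = g (\<iota> p) (d\<iota> p (T p u)) (d\<iota> p x)" for u x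
  proof -
    \<comment> \<open>Existence and uniqueness of the tangential part let the description defining
      \<open>T\<close> be unfolded; pairing with a tangent vector then removes the normal part
      \<open>n\<close>.\<close>
    obtain n where "n \<in> normal_space B A g \<iota> p" "\<phi> (\<iota> p) (d\<iota> p u) = d\<iota> p (T p u) + n"
      using theI'[OF ex1_tangential_part[OF L, of "\<phi> (\<iota> p) (d\<iota> p u)"]]
      unfolding T_def tangential_part_def normal_space_def d\<iota>_def by (elim bexE)
    then show ?thesis by (simp add: normal_space_def d\<iota>_def form_simps)
  qed
  have D2: "D\<^sub>2 p = {u. \<forall>w\<in>D\<^sub>1 p. g (\<iota> p) (d\<iota> p u) (d\<iota> p w) = 0}"
    by (simp add: D\<^sub>2_def orth_complement_def d\<iota>_def)
  have slant_at: "angle_subspace (g (\<iota> p)) (\<phi> (\<iota> p) (d\<iota> p u)) (d\<iota> p ` D\<^sub>2 p) = \<theta> p"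
    if "u \<in> D\<^sub>2 p" "u \<noteq> 0" "\<phi> (\<iota> p) (d\<iota> p u) \<noteq> 0" for u
    using bspec[OF slant that(1)] that(2,3) by (elim mp) (rule conjI)
  interpret semi_slant_point "g (\<iota> p)" "\<phi> (\<iota> p)" "\<xi> (\<iota> p)" "\<eta> (\<iota> p)" "d\<iota> p"
      "D\<^sub>1 p" "D\<^sub>2 p" "T p" "\<theta> p"
  proof (intro semi_slant_point.intro semi_slant_point_axioms.intro)
    show "contact_form (g (\<iota> p)) (\<phi> (\<iota> p)) (\<xi> (\<iota> p)) (\<eta> (\<iota> p))" ..
  qed (fact L D2 invariant slant_at tangential)+
  show ?thesis
    using assms(6,7) unfolding smooth_section_def by (simp add: T_squared)
qed

end
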